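(* Let $\mathtt z$ be a real, non-trivial (i.e. not almost surely constant) random variable with law $\zeta$, $\mathtt z\in\mathbb L^1$, $\mathbb E[\mathtt z]=0$ and $\sigma^2:=\mathbb E[\mathtt z^2]<\infty$. Then there exists $\Gamma_0>0$ such that for every $\Gamma\ge\Gamma_0$ and every $G=G_1-G_2$, with $G_1$ and $G_2$ risk functions of $\mathbb L^1$ random variables, $$\sum_{n=0}^\infty\big\|T_{\Gamma,0}^nG\big\|_1\le\frac{75}{\sigma^2}\,\Gamma^2\,\|G\|_1,$$ where $T_{\Gamma,0}$ is the operator defined in the context and $\|\cdot\|_1$ is the $L^1(\mathbb R,\mathrm dx)$ norm.
   Context: The risk function of a real random variable $A$ is $G_A(x)=\mathbb P(A>x)$. For $\Gamma>0$, $h_\Gamma(x)=\log\frac{e^{-\Gamma}+e^x}{1+e^{x-\Gamma}}$, an increasing bijection from $\mathbb R$ onto $(-\Gamma,\Gamma)$. For $G\in L^1(\mathbb R)$, $$T_{\Gamma,0}G(x):=\int_{(-\Gamma+x,\Gamma+x)}G\big(h_\Gamma^{-1}(x-z)\big)\,\zeta(\mathrm dz),\qquad x\in\mathbb R,$$ and $T_{\Gamma,0}^n$ is its $n$-th iterate. *)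

theory Defs
  imports "HOL-Probability.Probability"
begin

definition risk_function :: "'a measure \<Rightarrow> ('a \<Rightarrow> real) \<Rightarrow> real \<Rightarrow> real" where
  "risk_function M A x = measure M {\<omega> \<in> space M. A \<omega> > x}"

text \<open>
  Being the risk function of an integrable random variable involves an existential quantifier over
  probability spaces.  The sample space is taken to have carrier type \<open>real\<close>; by
  \<open>is_L1_risk_functionI\<close> below, integrable random variables on probability spaces over
  any other type yield no further risk functions.
\<close>

definition is_L1_risk_function :: "(real \<Rightarrow> real) \<Rightarrow> bool" where
  "is_L1_risk_function G \<longleftrightarrow>
     (\<exists>(M :: real measure) A. prob_space M \<and> integrable M A \<and> G = risk_function M A)"

lemma is_L1_risk_functionI:
  fixes M :: "'a measure" and A :: "'a \<Rightarrow> real"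
  assumes "prob_space M" and A: "integrable M A"
  shows "is_L1_risk_function (risk_function M A)"
proof -
  interpret prob_space M by fact
  have [measurable]: "A \<in> borel_measurable M" using A by simp
  have "prob_space (distr M borel A)" by (rule prob_space_distr) simp
  moreover have "integrable (distr M borel A) (\<lambda>x. x)"
    using A by (simp add: integrable_distr_eq)
  moreover have "risk_function M A = risk_function (distr M borel A) (\<lambda>x. x)"
  proof
    fix x
    have "measure (distr M borel A) {y. y > x} = measure M (A -` {y. y > x} \<inter> space M)"
      by (rule measure_distr) simp_all
    also have "A -` {y. y > x} \<inter> space M = {\<omega> \<in> space M. A \<omega> > x}" by auto
    finally show "risk_function M A x = risk_function (distr M borel A) (\<lambda>x. x) x"
      by (simp add: risk_function_def)
  qed
  ultimately show ?thesis unfolding is_L1_risk_function_def by blast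
qed

definition h :: "real \<Rightarrow> real \<Rightarrow> real" where
  "h \<Gamma> x = ln ((exp (- \<Gamma>) + exp x) / (1 + exp (x - \<Gamma>)))"

text \<open>
  The inverse of \<^term>\<open>h \<Gamma>\<close> is only ever used at points of its range: \<open>x - z\<close> lies in
  \<open>{- \<Gamma><..<\<Gamma>}\<close> for all \<open>z\<close> in the domain of integration (see \<open>bij_betw_h\<close>).
\<close>

definition T0 :: "real measure \<Rightarrow> real \<Rightarrow> (real \<Rightarrow> real) \<Rightarrow> real \<Rightarrow> real" where
  "T0 \<zeta> \<Gamma> G x = (LINT z:{- \<Gamma> + x<..<\<Gamma> + x}|\<zeta>. G (inv (h \<Gamma>) (x - z)))"

lemma h_strict_mono:
  assumes "\<Gamma> > 0"
  shows "strict_mono (h \<Gamma>)"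
proof (rule strict_monoI)
  fix x y :: real assume xy: "x < y"
  have e: "exp (- \<Gamma>) * exp (- \<Gamma>) < 1"
    using assms by (simp flip: exp_add)
  have "0 < (exp y - exp x) * (1 - exp (- \<Gamma>) * exp (- \<Gamma>))"
    using xy e by simp
  hence "(exp (- \<Gamma>) + exp x) * (1 + exp y * exp (- \<Gamma>))
       < (exp (- \<Gamma>) + exp y) * (1 + exp x * exp (- \<Gamma>))"
    by (simp add: algebra_simps)
  moreover have "exp (u - \<Gamma>) = exp u * exp (- \<Gamma>)" for u by (simp flip: exp_add)
  ultimately have "(exp (- \<Gamma>) + exp x) / (1 + exp (x - \<Gamma>))
       < (exp (- \<Gamma>) + exp y) / (1 + exp (y - \<Gamma>))"
    by (simp add: divide_less_eq less_divide_eq add_pos_pos frac_less_eq field_simps)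
  thus "h \<Gamma> x < h \<Gamma> y" 
    unfolding h_def by (subst ln_less_cancel_iff) (auto intro!: divide_pos_pos add_pos_pos)
qed

lemma bij_betw_h:
  assumes "\<Gamma> > 0"
  shows "bij_betw (h \<Gamma>) UNIV {- \<Gamma><..<\<Gamma>}"
  unfolding bij_betw_def
proof
  show "inj (h \<Gamma>)" using h_strict_mono[OF assms] by (rule strict_mono_imp_inj_on)
  define a where "a = exp (- \<Gamma>)"
  have a: "0 < a" "a < 1" using assms by (auto simp: a_def)
  have aa: "a * a < 1" using a mult_strict_mono[of a 1 a 1] by simp
  have ex: "exp (x - \<Gamma>) = a * exp x" for x by (simp add: a_def mult_exp_exp)
  have eh: "exp (h \<Gamma> x) = (a + exp x) / (1 + a * exp x)" for x
    unfolding h_def ex a_def[symmetric]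
    by (rule exp_ln) (use a in \<open>auto intro!: divide_pos_pos add_pos_pos\<close>)
  have ainv: "exp \<Gamma> = 1 / a" by (simp add: a_def exp_minus field_simps)
  have rng: "- \<Gamma> < y \<longleftrightarrow> a < exp y" "y < \<Gamma> \<longleftrightarrow> a * exp y < 1" for y
    using a ainv by (metis a_def exp_less_cancel_iff)
      (metis a(1) ainv exp_less_cancel_iff less_divide_eq mult.commute)
  show "range (h \<Gamma>) = {- \<Gamma><..<\<Gamma>}"
  proof (intro equalityI subsetI)
    fix y assume "y \<in> range (h \<Gamma>)"
    then obtain x where y: "y = h \<Gamma> x" by auto
    have p: "0 < 1 + a * exp x" using a by (simp add: add_pos_pos)
    have q: "a * a * exp x < exp x" using aa by simp
    have "a < exp y" unfolding y eh using p q by (simp add: less_divide_eq algebra_simps)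
    moreover have "a * exp y < 1" unfolding y eh using p aa
      by (simp add: divide_less_eq algebra_simps)
    ultimately show "y \<in> {- \<Gamma><..<\<Gamma>}" using rng by simp
  next
    fix y assume "y \<in> {- \<Gamma><..<\<Gamma>}"
    hence y: "a < exp y" "a * exp y < 1" using rng by auto
    define t where "t = (exp y - a) / (1 - a * exp y)"
    have t: "t > 0" using y by (simp add: t_def)
    have d: "1 + a * t > 0" using a t by (simp add: add_pos_pos)
    have "t * (1 - a * exp y) = exp y - a" using y by (simp add: t_def)
    hence "(a + t) / (1 + a * t) = exp y" using d by (simp add: divide_eq_eq algebra_simps)
    hence "exp (h \<Gamma> (ln t)) = exp y" using t by (simp add: eh)
    hence "y = h \<Gamma> (ln t)" by simp
    thus "y \<in> range (h \<Gamma>)" by auto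
  qed
qed

definition L1_norm :: "(real \<Rightarrow> real) \<Rightarrow> real" where
  "L1_norm f = (LINT x|lborel. \<bar>f x\<bar>)"

end

theory Submission
  imports Defs
begin

text \<open>
  Substituting \<open>w = x - z\<close> and then \<open>w = h \<Gamma> y\<close> in the definition of \<^const>\<open>T0\<close> shows that its
  adjoint acts on weights by \<open>W \<mapsto> (\<lambda>y. h' y * E W (h y + z))\<close>: it is the transition operator of
  the Markov chain \<open>y \<mapsto> h y + z\<close> which at each step survives with probability \<open>h' y \<in> [0, 1]\<close>.
  Summing the norms of the iterates therefore amounts to bounding the expected lifetime of this
  chain, uniformly in its starting point.  Such a bound follows from a potential: a function \<open>V\<close>
  with \<open>1 + h' y * E V (h y + z) \<le> V y\<close> and \<open>0 \<le> V \<le> c\<close> makes \<open>\<integral> \<bar>G\<bar> * V\<close> decrease by at least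
  the \<open>L\<^sup>1\<close> norm of \<open>G\<close> when \<open>G\<close> is replaced by its image, and these decreases add up to at most
  \<open>c\<close> times the norm of the initial \<open>G\<close> (lemmas \<open>T0_weighted_duality\<close> and \<open>T0_iterates_summable\<close>).

  Inside \<open>{- \<Gamma>..\<Gamma>}\<close> the chain is almost a centred random walk of variance \<open>s\<close>, and outside it
  dies with probability at least \<open>1 / 2\<close>, so the lifetime has the order \<open>\<Gamma>\<^sup>2 / s\<close> of an exit time.
  The potential is the corresponding quadratic, capped at distance \<open>2 * \<Gamma>\<close>:
  \<open>V y = 2 / s * (9 * \<Gamma>\<^sup>2 - min (y\<^sup>2) ((2 * \<Gamma>)\<^sup>2))\<close>, whose values lie between \<open>10 * \<Gamma>\<^sup>2 / s\<close> and
  \<open>18 * \<Gamma>\<^sup>2 / s\<close>.  Three facts give the required inequality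
  (lemma \<open>capped_potential_superharmonic\<close>).
  For \<open>\<bar>y\<bar> \<ge> \<Gamma>\<close> it suffices that \<open>h' y \<le> 1 / 2\<close>, since the minimum of \<open>V\<close> exceeds half of its
  maximum by \<open>\<Gamma>\<^sup>2 / s\<close>.
  For \<open>\<bar>y\<bar> < \<Gamma>\<close> the walk lowers the expected quadratic by a constant; the cap, reached only by
  jumps longer than \<open>\<Gamma>\<close>, costs an arbitrarily small part of the second moment once \<open>\<Gamma>\<close> is large.
  Finally the drift \<open>y - h y\<close>, which could raise \<open>s * V\<close> by an amount of order \<open>\<Gamma> * \<bar>y - h y\<bar>\<close>, is
  compensated by the loss of order \<open>(1 - h' y) * \<Gamma>\<^sup>2\<close> due to killing, because
  \<open>\<bar>y - h y\<bar> \<le> 2 * (1 - h' y)\<close>.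
\<close>

section \<open>The map h and its derivative\<close>

definition h_slope :: "real \<Rightarrow> real \<Rightarrow> real" where
  "h_slope \<Gamma> y = 1 - exp (y - \<Gamma>) / (1 + exp (y - \<Gamma>)) - exp (- \<Gamma> - y) / (1 + exp (- \<Gamma> - y))"

lemma h_eq_self_plus:
  "h \<Gamma> y = y + ln (1 + exp (- \<Gamma> - y)) - ln (1 + exp (y - \<Gamma>))"
proof -
  have "exp (- \<Gamma>) + exp y = exp y * (1 + exp (- \<Gamma> - y))"
    by (simp add: distrib_left flip: exp_add)
  moreover have pos: "0 < 1 + exp (- \<Gamma> - y)" "0 < 1 + exp (y - \<Gamma>)"
    by (auto intro: add_pos_pos)
  ultimately show ?thesis
    unfolding h_def by (simp add: ln_div ln_mult)
qed

lemma has_real_derivative_h: "(h \<Gamma> has_real_derivative h_slope \<Gamma> y) (at y)"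
proof -
  have pos: "0 < 1 + exp (- \<Gamma> - y)" "0 < 1 + exp (y - \<Gamma>)"
    by (auto intro: add_pos_pos)
  have "((\<lambda>y. y + ln (1 + exp (- \<Gamma> - y)) - ln (1 + exp (y - \<Gamma>)))
      has_real_derivative h_slope \<Gamma> y) (at y)"
    using pos by (auto intro!: derivative_eq_intros simp: h_slope_def divide_inverse)
  thus ?thesis by (simp add: h_eq_self_plus[abs_def])
qed

lemma h_slope_nonneg:
  assumes "\<Gamma> > 0"
  shows "0 \<le> h_slope \<Gamma> y"
proof -
  define p q where "p = exp (y - \<Gamma>)" and "q = exp (- \<Gamma> - y)"
  have pos: "p > 0" "q > 0" by (auto simp: p_def q_def)
  have "p * q = exp (- 2 * \<Gamma>)" by (simp add: p_def q_def flip: exp_add)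
  hence pq: "p * q \<le> 1" using assms by simp
  have "p / (1 + p) + q / (1 + q) = (p + q + 2 * (p * q)) / (1 + p + q + p * q)"
    using pos by (simp add: add_frac_eq) (simp add: algebra_simps)
  also have "\<dots> \<le> 1"
  proof -
    have "0 < 1 + p + q + p * q" using pos by (intro add_pos_pos mult_pos_pos) auto
    thus ?thesis using pq by (simp add: divide_le_eq)
  qed
  finally show ?thesis by (simp add: h_slope_def p_def q_def)
qed

lemma h_slope_le_half:
  assumes "\<Gamma> \<le> \<bar>y\<bar>"
  shows "h_slope \<Gamma> y \<le> 1 / 2"
proof -
  have half: "1 / 2 \<le> exp t / (1 + exp t)" if "t \<ge> 0" for t :: real
    using that by (simp add: le_divide_eq add_pos_pos)
  have nonneg: "0 \<le> exp t / (1 + exp t)" for t :: real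
    by (simp add: add_nonneg_nonneg)
  show ?thesis
  proof (cases "y \<ge> 0")
    case True
    thus ?thesis using half[of "y - \<Gamma>"] nonneg[of "- \<Gamma> - y"] assms unfolding h_slope_def by linarith
  next
    case False
    thus ?thesis using half[of "- \<Gamma> - y"] nonneg[of "y - \<Gamma>"] assms unfolding h_slope_def by linarith
  qed
qed

text \<open>
  With \<open>p = exp (y - \<Gamma>)\<close> and \<open>q = exp (- \<Gamma> - y)\<close> both sides have the size of \<open>p + q\<close>: the drift
  \<open>ln (1 + p) - ln (1 + q)\<close> is bounded by it because \<open>ln (1 + t) \<le> t\<close>, and the defect
  \<open>p / (1 + p) + q / (1 + q)\<close> is at least half of it because \<open>p\<close> and \<open>q\<close> are at most \<open>1\<close>.
\<close>

lemma h_drift_le_slope_defect: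
  assumes "\<bar>y\<bar> \<le> \<Gamma>"
  shows "\<bar>y - h \<Gamma> y\<bar> \<le> 2 * (1 - h_slope \<Gamma> y)"
proof -
  define p q where "p = exp (y - \<Gamma>)" and "q = exp (- \<Gamma> - y)"
  have pos: "0 < p" "0 < q" and le1: "p \<le> 1" "q \<le> 1" using assms by (auto simp: p_def q_def)
  have half: "t \<le> 2 * (t / (1 + t))" if "0 < t" "t \<le> 1" for t :: real
    using that mult_left_le[of t t] by (simp add: le_divide_eq algebra_simps)
  have "\<bar>y - h \<Gamma> y\<bar> = \<bar>ln (1 + p) - ln (1 + q)\<bar>"
    by (simp add: h_eq_self_plus p_def q_def)
  also have "\<dots> \<le> p + q"
    using pos ln_add_one_self_le_self[of p] ln_add_one_self_le_self[of q]
      ln_ge_zero[of "1 + p"] ln_ge_zero[of "1 + q"] by linarith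
  also have "\<dots> \<le> 2 * (p / (1 + p)) + 2 * (q / (1 + q))"
    using half[of p] half[of q] pos le1 by linarith
  also have "\<dots> = 2 * (1 - h_slope \<Gamma> y)" by (simp add: h_slope_def p_def q_def)
  finally show ?thesis .
qed

lemma h_bounded: "\<Gamma> > 0 \<Longrightarrow> \<bar>h \<Gamma> y\<bar> < \<Gamma>"
  using bij_betw_apply[OF bij_betw_h, of \<Gamma> y] by auto

lemma inv_h_h: "\<Gamma> > 0 \<Longrightarrow> inv (h \<Gamma>) (h \<Gamma> y) = y"
  using bij_betw_h[of \<Gamma>] by (simp add: bij_betw_def)

text \<open>
  The value \<open>0\<close> off the range of \<^term>\<open>h \<Gamma>\<close> makes the inverse Borel measurable on the whole line,
  which gives the integrand of \<^const>\<open>T0\<close> joint measurability.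
\<close>

definition h_inverse :: "real \<Rightarrow> real \<Rightarrow> real" where
  "h_inverse \<Gamma> w = (if w \<in> {- \<Gamma><..<\<Gamma>} then inv (h \<Gamma>) w else 0)"

lemma borel_measurable_h_inverse:
  assumes "\<Gamma> > 0"
  shows "h_inverse \<Gamma> \<in> borel_measurable borel"
proof -
  have "mono_on {- \<Gamma><..<\<Gamma>} (inv (h \<Gamma>))"
  proof (rule mono_onI)
    fix u v :: real
    assume "u \<in> {- \<Gamma><..<\<Gamma>}" "v \<in> {- \<Gamma><..<\<Gamma>}" "u \<le> v"
    moreover then obtain x y where "u = h \<Gamma> x" "v = h \<Gamma> y"
      using bij_betw_h[OF assms] unfolding bij_betw_def by blast
    ultimately show "inv (h \<Gamma>) u \<le> inv (h \<Gamma>) v"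
      using strict_mono_less_eq[OF h_strict_mono[OF assms]] by (simp add: inv_h_h assms)
  qed
  hence "inv (h \<Gamma>) \<in> borel_measurable (restrict_space borel {- \<Gamma><..<\<Gamma>})"
    by (rule borel_measurable_mono_on_fnc)
  hence "(\<lambda>w. if w \<in> {- \<Gamma><..<\<Gamma>} then inv (h \<Gamma>) w else 0) \<in> borel_measurable borel"
    by (subst (asm) measurable_restrict_space_iff[where c = 0]) auto
  thus ?thesis by (simp add: h_inverse_def[abs_def])
qed

section \<open>Duality\<close>

text \<open>
  The change of variables holds on each compact interval \<open>{h (- b)..h b}\<close>; these exhaust the open
  range of \<open>h\<close>, and monotone convergence passes to the limit.
\<close>

lemma nn_integral_substitution_h:
  fixes f :: "real \<Rightarrow> ennreal"
  assumes [measurable]: "f \<in> borel_measurable borel" and \<Gamma>: "\<Gamma> > 0"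
  shows "(\<integral>\<^sup>+w. f w * indicator {- \<Gamma><..<\<Gamma>} w \<partial>lborel)
       = (\<integral>\<^sup>+y. f (h \<Gamma> y) * ennreal (h_slope \<Gamma> y) \<partial>lborel)"
proof -
  define b where "b n = real n + 1" for n
  have mono: "strict_mono (h \<Gamma>)" using h_strict_mono[OF \<Gamma>] .
  have hm[measurable]: "h \<Gamma> \<in> borel_measurable borel"
    by (rule borel_measurable_mono) (rule strict_mono_mono[OF mono])
  have cont: "continuous_on A (h_slope \<Gamma>)" for A
    unfolding h_slope_def[abs_def]
    by (intro continuous_intros) (auto intro!: add_pos_pos less_imp_neq[THEN not_sym])
  have sm[measurable]: "h_slope \<Gamma> \<in> borel_measurable borel"
    by (rule borel_measurable_continuous_onI[OF cont])
  have exhaust: "{- \<Gamma><..<\<Gamma>} = (\<Union>n. {h \<Gamma> (- b n)..h \<Gamma> (b n)})"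
  proof (intro equalityI subsetI)
    fix w assume "w \<in> {- \<Gamma><..<\<Gamma>}"
    then obtain y where y: "w = h \<Gamma> y" using bij_betw_h[OF \<Gamma>] unfolding bij_betw_def by blast
    obtain n where "\<bar>y\<bar> \<le> real n" using real_arch_simple by blast
    hence "- b n \<le> y" "y \<le> b n" by (auto simp: b_def)
    hence "w \<in> {h \<Gamma> (- b n)..h \<Gamma> (b n)}"
      by (simp add: y strict_mono_less_eq[OF mono])
    thus "w \<in> (\<Union>n. {h \<Gamma> (- b n)..h \<Gamma> (b n)})" by blast
  next
    fix w assume "w \<in> (\<Union>n. {h \<Gamma> (- b n)..h \<Gamma> (b n)})"
    then obtain n where "h \<Gamma> (- b n) \<le> w" "w \<le> h \<Gamma> (b n)" by auto
    thus "w \<in> {- \<Gamma><..<\<Gamma>}" using h_bounded[OF \<Gamma>, of "- b n"] h_bounded[OF \<Gamma>, of "b n"] by auto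
  qed
  have inc: "incseq (\<lambda>n. {h \<Gamma> (- b n)..h \<Gamma> (b n)})"
    by (auto simp: incseq_def b_def strict_mono_less_eq[OF mono]
        intro: order_trans[rotated] order_trans)
  have inc': "incseq (\<lambda>n. {- b n..b n})" by (auto simp: incseq_def b_def)
  have exhaust': "(\<Union>n. {- b n..b n}) = UNIV"
  proof -
    have "\<exists>n. y \<in> {- b n..b n}" for y
    proof -
      obtain n where "\<bar>y\<bar> \<le> real n" using real_arch_simple by blast
      thus ?thesis by (intro exI[of _ n]) (auto simp: b_def)
    qed
    thus ?thesis by blast
  qed
  have lim: "(\<integral>\<^sup>+x. g x * indicator (\<Union>n. A n) x \<partial>lborel)
        = (SUP n. \<integral>\<^sup>+x. g x * indicator (A n) x \<partial>lborel)"
    if A: "incseq A" "\<And>n. A n \<in> sets borel" and [measurable]: "g \<in> borel_measurable borel"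
    for g :: "real \<Rightarrow> ennreal" and A :: "nat \<Rightarrow> real set"
  proof -
    note A(2)[measurable]
    have "(\<integral>\<^sup>+x. g x * indicator (\<Union>n. A n) x \<partial>lborel) = emeasure (density lborel g) (\<Union>n. A n)"
      by (subst emeasure_density) auto
    also have "\<dots> = (SUP n. emeasure (density lborel g) (A n))"
      using A by (intro SUP_emeasure_incseq[symmetric]) auto
    also have "\<dots> = (SUP n. \<integral>\<^sup>+x. g x * indicator (A n) x \<partial>lborel)"
      by (subst emeasure_density) auto
    finally show ?thesis .
  qed
  have "(\<integral>\<^sup>+w. f w * indicator {- \<Gamma><..<\<Gamma>} w \<partial>lborel)
      = (SUP n. \<integral>\<^sup>+w. f w * indicator {h \<Gamma> (- b n)..h \<Gamma> (b n)} w \<partial>lborel)"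
    unfolding exhaust by (rule lim[OF inc]) auto
  also have "\<dots> = (SUP n. \<integral>\<^sup>+y. f (h \<Gamma> y) * ennreal (h_slope \<Gamma> y) * indicator {- b n..b n} y \<partial>lborel)"
    by (intro SUP_cong refl nn_integral_substitution_aux)
      (auto intro: has_real_derivative_h h_slope_nonneg \<Gamma> cont simp: b_def)
  also have "\<dots> = (\<integral>\<^sup>+y. f (h \<Gamma> y) * ennreal (h_slope \<Gamma> y) * indicator (\<Union>n. {- b n..b n}) y \<partial>lborel)"
    by (rule lim[OF inc', symmetric]) auto
  finally show ?thesis by (simp add: exhaust')
qed

lemma nn_integral_lborel_shift:
  fixes f :: "real \<Rightarrow> ennreal"
  assumes [measurable]: "f \<in> borel_measurable borel"
  shows "(\<integral>\<^sup>+x. f x \<partial>lborel) = (\<integral>\<^sup>+w. f (w + c) \<partial>lborel)"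
proof -
  have "(\<integral>\<^sup>+x. f x \<partial>lborel) = (\<integral>\<^sup>+x. f x \<partial>distr lborel borel ((+) c))"
    by (simp add: lborel_distr_plus)
  also have "\<dots> = (\<integral>\<^sup>+w. f (c + w) \<partial>lborel)" by (rule nn_integral_distr) auto
  finally show ?thesis by (simp add: add.commute)
qed

lemma T0_conv_h_inverse:
  "T0 \<zeta> \<Gamma> G x = (LINT z|\<zeta>. indicator {- \<Gamma><..<\<Gamma>} (x - z) * G (h_inverse \<Gamma> (x - z)))"
  unfolding T0_def set_lebesgue_integral_def
  by (rule Bochner_Integration.integral_cong) (auto simp: indicator_def h_inverse_def)

lemma borel_measurable_T0:
  assumes "prob_space \<zeta>" and [measurable_cong]: "sets \<zeta> = sets borel" and "\<Gamma> > 0"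
    and [measurable]: "G \<in> borel_measurable borel"
  shows "T0 \<zeta> \<Gamma> G \<in> borel_measurable borel"
proof -
  interpret prob_space \<zeta> by fact
  note borel_measurable_h_inverse[OF \<open>\<Gamma> > 0\<close>, measurable]
  show ?thesis unfolding T0_conv_h_inverse[abs_def] by measurable
qed

text \<open>
  The adjoint of \<^const>\<open>T0\<close>: after taking absolute values inside the integral, Tonelli's theorem
  and the substitutions \<open>x = w + z\<close>, \<open>w = h y\<close> move the operator from \<open>G\<close> to the weight.  The only
  loss is the triangle inequality.
\<close>

lemma T0_weighted_duality:
  fixes W :: "real \<Rightarrow> ennreal"
  assumes "prob_space \<zeta>" and [measurable_cong]: "sets \<zeta> = sets borel" and \<Gamma>: "\<Gamma> > 0"
    and [measurable]: "G \<in> borel_measurable borel" "W \<in> borel_measurable borel"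
  shows "(\<integral>\<^sup>+x. ennreal \<bar>T0 \<zeta> \<Gamma> G x\<bar> * W x \<partial>lborel)
       \<le> (\<integral>\<^sup>+y. ennreal \<bar>G y\<bar> * (ennreal (h_slope \<Gamma> y) * (\<integral>\<^sup>+z. W (h \<Gamma> y + z) \<partial>\<zeta>)) \<partial>lborel)"
proof -
  interpret prob_space \<zeta> by fact
  interpret pair_sigma_finite lborel \<zeta> ..
  note borel_measurable_h_inverse[OF \<Gamma>, measurable]
  define F where "F w = ennreal \<bar>G (h_inverse \<Gamma> w)\<bar> * indicator {- \<Gamma><..<\<Gamma>} w" for w
  have [measurable]: "F \<in> borel_measurable borel" unfolding F_def by measurable
  have abs_T0: "ennreal \<bar>T0 \<zeta> \<Gamma> G x\<bar> \<le> (\<integral>\<^sup>+z. F (x - z) \<partial>\<zeta>)" for x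
  proof -
    let ?f = "\<lambda>z. indicator {- \<Gamma><..<\<Gamma>} (x - z) * G (h_inverse \<Gamma> (x - z))"
    have "ennreal \<bar>LINT z|\<zeta>. ?f z\<bar> \<le> (\<integral>\<^sup>+z. ennreal \<bar>?f z\<bar> \<partial>\<zeta>)"
    proof (cases "integrable \<zeta> ?f")
      case True
      thus ?thesis using integral_norm_bound_ennreal[OF True] by simp
    qed (simp add: not_integrable_integral_eq)
    also have "\<dots> = (\<integral>\<^sup>+z. F (x - z) \<partial>\<zeta>)"
      by (intro nn_integral_cong) (auto simp: F_def indicator_def)
    finally show ?thesis by (simp add: T0_conv_h_inverse)
  qed
  have "(\<integral>\<^sup>+x. ennreal \<bar>T0 \<zeta> \<Gamma> G x\<bar> * W x \<partial>lborel)
      \<le> (\<integral>\<^sup>+x. (\<integral>\<^sup>+z. F (x - z) \<partial>\<zeta>) * W x \<partial>lborel)"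
    by (intro nn_integral_mono mult_right_mono abs_T0) auto
  also have "\<dots> = (\<integral>\<^sup>+x. (\<integral>\<^sup>+z. F (x - z) * W x \<partial>\<zeta>) \<partial>lborel)"
    by (intro nn_integral_cong nn_integral_multc[symmetric]) measurable
  also have "\<dots> = (\<integral>\<^sup>+z. (\<integral>\<^sup>+x. F (x - z) * W x \<partial>lborel) \<partial>\<zeta>)"
    by (rule Fubini'[symmetric]) measurable
  also have "\<dots> = (\<integral>\<^sup>+z. (\<integral>\<^sup>+w. F w * W (w + z) \<partial>lborel) \<partial>\<zeta>)"
  proof (rule nn_integral_cong)
    fix z
    show "(\<integral>\<^sup>+x. F (x - z) * W x \<partial>lborel) = (\<integral>\<^sup>+w. F w * W (w + z) \<partial>lborel)"
      by (subst nn_integral_lborel_shift[where c = z]) auto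
  qed
  also have "\<dots> = (\<integral>\<^sup>+w. (\<integral>\<^sup>+z. F w * W (w + z) \<partial>\<zeta>) \<partial>lborel)"
    by (rule Fubini') measurable
  also have "\<dots> = (\<integral>\<^sup>+w. (ennreal \<bar>G (h_inverse \<Gamma> w)\<bar> * (\<integral>\<^sup>+z. W (w + z) \<partial>\<zeta>))
                         * indicator {- \<Gamma><..<\<Gamma>} w \<partial>lborel)"
    by (intro nn_integral_cong) (auto simp: F_def nn_integral_cmult indicator_def)
  also have "\<dots> = (\<integral>\<^sup>+y. (ennreal \<bar>G (h_inverse \<Gamma> (h \<Gamma> y))\<bar> * (\<integral>\<^sup>+z. W (h \<Gamma> y + z) \<partial>\<zeta>))
                         * ennreal (h_slope \<Gamma> y) \<partial>lborel)"
    by (rule nn_integral_substitution_h[OF _ \<Gamma>]) measurable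
  also have "\<dots> = (\<integral>\<^sup>+y. ennreal \<bar>G y\<bar> * (ennreal (h_slope \<Gamma> y) * (\<integral>\<^sup>+z. W (h \<Gamma> y + z) \<partial>\<zeta>)) \<partial>lborel)"
  proof (intro nn_integral_cong)
    fix y
    have "h \<Gamma> y \<in> {- \<Gamma><..<\<Gamma>}" using h_bounded[OF \<Gamma>, of y] by auto
    hence "h_inverse \<Gamma> (h \<Gamma> y) = y" by (simp add: h_inverse_def inv_h_h \<Gamma>)
    thus "(ennreal \<bar>G (h_inverse \<Gamma> (h \<Gamma> y))\<bar> * (\<integral>\<^sup>+z. W (h \<Gamma> y + z) \<partial>\<zeta>)) * ennreal (h_slope \<Gamma> y)
        = ennreal \<bar>G y\<bar> * (ennreal (h_slope \<Gamma> y) * (\<integral>\<^sup>+z. W (h \<Gamma> y + z) \<partial>\<zeta>))"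
      by (simp add: mult_ac)
  qed
  finally show ?thesis .
qed

text \<open>
  The superharmonicity of \<open>V\<close> and duality make \<open>\<integral> \<bar>G\<bar> * V\<close> drop by at least the norm of \<open>G\<close>
  whenever \<^const>\<open>T0\<close> is applied.  The drops telescope, so that their sum is at most the initial
  value.
\<close>

lemma T0_iterates_summable:
  fixes V :: "real \<Rightarrow> ennreal" and c :: real
  assumes "prob_space \<zeta>" and "sets \<zeta> = sets borel" and "\<Gamma> > 0"
    and [measurable]: "V \<in> borel_measurable borel" and G: "integrable lborel G"
    and super: "\<And>y. 1 + ennreal (h_slope \<Gamma> y) * (\<integral>\<^sup>+z. V (h \<Gamma> y + z) \<partial>\<zeta>) \<le> V y"
    and bound: "\<And>y. V y \<le> ennreal c" and c: "c \<ge> 0"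
  defines "T \<equiv> T0 \<zeta> \<Gamma>"
  shows "integrable lborel ((T ^^ n) G)"
    and "summable (\<lambda>n. L1_norm ((T ^^ n) G))"
    and "(\<Sum>n. L1_norm ((T ^^ n) G)) \<le> c * L1_norm G"
proof -
  define H where "H n = (T ^^ n) G" for n
  define \<phi> where "\<phi> n = (\<integral>\<^sup>+x. ennreal \<bar>H n x\<bar> * V x \<partial>lborel)" for n
  define a where "a n = (\<integral>\<^sup>+x. ennreal \<bar>H n x\<bar> \<partial>lborel)" for n
  have H[measurable]: "H n \<in> borel_measurable borel" for n
  proof (induction n)
    case 0
    thus ?case using G by (simp add: H_def)
  next
    case (Suc n)
    have "H (Suc n) = T0 \<zeta> \<Gamma> (H n)" by (simp add: H_def T_def)
    thus ?case using borel_measurable_T0[OF assms(1-3) Suc] by simp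
  qed
  have ma[measurable]: "(\<lambda>x. ennreal \<bar>H n x\<bar>) \<in> borel_measurable lborel" for n by measurable
  have drop: "a n + \<phi> (Suc n) \<le> \<phi> n" for n
  proof -
    let ?P = "\<lambda>y. ennreal (h_slope \<Gamma> y) * (\<integral>\<^sup>+z. V (h \<Gamma> y + z) \<partial>\<zeta>)"
    have "H (Suc n) = T0 \<zeta> \<Gamma> (H n)" by (simp add: H_def T_def)
    hence "a n + \<phi> (Suc n) \<le> a n + (\<integral>\<^sup>+y. ennreal \<bar>H n y\<bar> * ?P y \<partial>lborel)"
      unfolding \<phi>_def using T0_weighted_duality[OF assms(1-3) H, of V] by (intro add_left_mono) simp
    also have "\<dots> \<le> (\<integral>\<^sup>+y. ennreal \<bar>H n y\<bar> * (1 + ?P y) \<partial>lborel)"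
    proof -
      interpret prob_space \<zeta> by fact
      note assms(2)[measurable_cong]
      have [measurable]: "h \<Gamma> \<in> borel_measurable borel" "h_slope \<Gamma> \<in> borel_measurable borel"
        unfolding h_def[abs_def] h_slope_def[abs_def] by measurable
      show ?thesis unfolding a_def
        by (subst nn_integral_add[symmetric]) (auto simp: distrib_left)
    qed
    also have "\<dots> \<le> \<phi> n"
      unfolding \<phi>_def by (intro nn_integral_mono mult_left_mono super) auto
    finally show ?thesis .
  qed
  have tele: "(\<Sum>k<N. a k) + \<phi> N \<le> \<phi> 0" for N
  proof (induction N)
    case (Suc N)
    have "(\<Sum>k<Suc N. a k) + \<phi> (Suc N) = (\<Sum>k<N. a k) + (a N + \<phi> (Suc N))" by (simp add: add.assoc)
    also have "\<dots> \<le> (\<Sum>k<N. a k) + \<phi> N" by (intro add_left_mono drop)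
    finally show ?case using Suc by (rule order_trans)
  qed simp
  have a0: "a 0 = ennreal (L1_norm G)"
    using G unfolding a_def H_def L1_norm_def by (subst nn_integral_eq_integral) auto
  have "\<phi> 0 \<le> (\<integral>\<^sup>+x. ennreal \<bar>H 0 x\<bar> * ennreal c \<partial>lborel)"
    unfolding \<phi>_def by (intro nn_integral_mono mult_left_mono bound) auto
  also have "\<dots> = ennreal (c * L1_norm G)"
    using c a0 by (subst nn_integral_multc) (auto simp: a_def ennreal_mult' mult.commute)
  finally have \<phi>0: "\<phi> 0 \<le> ennreal (c * L1_norm G)" .
  have sum_a: "(\<Sum>k<N. a k) \<le> ennreal (c * L1_norm G)" for N
  proof -
    have "(\<Sum>k<N. a k) \<le> (\<Sum>k<N. a k) + \<phi> N" by simp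
    also note tele
    also note \<phi>0
    finally show ?thesis .
  qed
  have fin: "a n < \<infinity>" for n
  proof -
    have "a n \<le> (\<Sum>k<Suc n. a k)" by (simp add: add_increasing)
    also have "\<dots> < \<infinity>"
      using le_less_trans[OF sum_a[of "Suc n"] ennreal_less_top] by (simp del: sum.lessThan_Suc)
    finally show ?thesis .
  qed
  have int: "integrable lborel (H n)" for n
    using fin[of n] by (intro integrableI_bounded) (auto simp: a_def)
  thus "integrable lborel ((T ^^ n) G)" by (simp add: H_def)
  have a: "a n = ennreal (L1_norm (H n))" for n
    using int unfolding a_def L1_norm_def by (subst nn_integral_eq_integral) auto
  have L1_nonneg: "0 \<le> L1_norm f" for f by (simp add: L1_norm_def)
  have part: "(\<Sum>k<N. L1_norm (H k)) \<le> c * L1_norm G" for N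
    using sum_a[of N] c L1_nonneg by (simp add: a sum_ennreal ennreal_le_iff)
  have "summable (\<lambda>n. L1_norm (H n))"
    using part L1_nonneg by (intro summableI_nonneg_bounded)
  thus "summable (\<lambda>n. L1_norm ((T ^^ n) G))"
    and "(\<Sum>n. L1_norm ((T ^^ n) G)) \<le> c * L1_norm G"
    using suminf_le_const[OF _ part] by (simp_all add: H_def)
qed

section \<open>The quadratic potential\<close>

text \<open>
  The exit-time potential of a centred walk of variance \<open>s\<close> is \<open>(const - y\<^sup>2) / s\<close>; the factor \<open>2\<close>
  leaves room for the loss caused by the cap.  The cap sits at \<open>2 * \<Gamma>\<close> rather than \<open>\<Gamma>\<close> so
  that only jumps longer than \<open>\<Gamma>\<close> reach it from \<open>{- \<Gamma>..\<Gamma>}\<close>, and \<open>9 > 2 * 2\<^sup>2\<close> keeps the minimum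
  above half of the maximum.
\<close>

definition capped_potential :: "real \<Rightarrow> real \<Rightarrow> real \<Rightarrow> real" where
  "capped_potential s \<Gamma> y = 2 / s * (9 * \<Gamma>\<^sup>2 - min (y\<^sup>2) ((2 * \<Gamma>)\<^sup>2))"

lemma capped_potential_bounds:
  assumes "s > 0"
  shows "10 / s * \<Gamma>\<^sup>2 \<le> capped_potential s \<Gamma> y" "capped_potential s \<Gamma> y \<le> 18 / s * \<Gamma>\<^sup>2"
proof -
  have "5 * \<Gamma>\<^sup>2 \<le> 9 * \<Gamma>\<^sup>2 - min (y\<^sup>2) ((2 * \<Gamma>)\<^sup>2)"
    by (simp add: power_mult_distrib min_def)
  hence "2 / s * (5 * \<Gamma>\<^sup>2) \<le> capped_potential s \<Gamma> y"
    unfolding capped_potential_def using assms by (intro mult_left_mono) auto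
  thus "10 / s * \<Gamma>\<^sup>2 \<le> capped_potential s \<Gamma> y" by simp
  have "9 * \<Gamma>\<^sup>2 - min (y\<^sup>2) ((2 * \<Gamma>)\<^sup>2) \<le> 9 * \<Gamma>\<^sup>2" by simp
  hence "capped_potential s \<Gamma> y \<le> 2 / s * (9 * \<Gamma>\<^sup>2)"
    unfolding capped_potential_def using assms by (intro mult_left_mono) auto
  thus "capped_potential s \<Gamma> y \<le> 18 / s * \<Gamma>\<^sup>2" by simp
qed

text \<open>
  The cap truncates the square only when \<open>\<bar>z\<bar> \<ge> \<Gamma> \<ge> \<bar>w\<bar>\<close>, and then the whole square is at most \<open>4 * z\<^sup>2\<close>.
\<close>

lemma capped_square_ge:
  fixes w z \<Gamma> :: real
  assumes "\<bar>w\<bar> \<le> \<Gamma>"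
  shows "(w + z)\<^sup>2 - 4 * (z\<^sup>2 * indicator {x. \<Gamma> \<le> \<bar>x\<bar>} z) \<le> min ((w + z)\<^sup>2) ((2 * \<Gamma>)\<^sup>2)"
proof (cases "\<Gamma> \<le> \<bar>z\<bar>")
  case True
  have "\<bar>w + z\<bar> \<le> 2 * \<bar>z\<bar>" using assms True by linarith
  hence "(w + z)\<^sup>2 \<le> (2 * \<bar>z\<bar>)\<^sup>2" by (metis abs_ge_zero power2_abs power_mono)
  hence "(w + z)\<^sup>2 - 4 * (z\<^sup>2 * indicator {x. \<Gamma> \<le> \<bar>x\<bar>} z) \<le> 0"
    using True by (simp add: power_mult_distrib)
  also have "0 \<le> min ((w + z)\<^sup>2) ((2 * \<Gamma>)\<^sup>2)" by simp
  finally show ?thesis .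
next
  case False
  hence "\<bar>w + z\<bar> \<le> 2 * \<Gamma>" using assms by linarith
  hence "(w + z)\<^sup>2 \<le> (2 * \<Gamma>)\<^sup>2" by (metis abs_ge_zero power2_abs power_mono)
  thus ?thesis using False by simp
qed

text \<open>
  Without the cap, \<open>E (w + z)\<^sup>2 = w\<^sup>2 + s\<close>; the cap costs at most four times the tail of the second
  moment, that is at most half of the variance.
\<close>

lemma expected_capped_potential_le:
  assumes "prob_space \<zeta>" and sets[measurable_cong]: "sets \<zeta> = sets borel"
    and int: "integrable \<zeta> (\<lambda>x. x)" "integrable \<zeta> (\<lambda>x. x\<^sup>2)" and mean: "(LINT x|\<zeta>. x) = 0"
    and s: "s = (LINT x|\<zeta>. x\<^sup>2)" "s > 0"
    and tail: "(LINT x|\<zeta>. x\<^sup>2 * indicator {x. \<Gamma> \<le> \<bar>x\<bar>} x) \<le> s / 8"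
    and w: "\<bar>w\<bar> \<le> \<Gamma>"
  shows "(LINT z|\<zeta>. capped_potential s \<Gamma> (w + z)) \<le> 2 / s * (9 * \<Gamma>\<^sup>2 - w\<^sup>2 - s / 2)"
proof -
  interpret prob_space \<zeta> by fact
  let ?t = "\<lambda>x. x\<^sup>2 * indicator {x. \<Gamma> \<le> \<bar>x\<bar>} x :: real"
  have tail_int: "integrable \<zeta> ?t"
    using int(2) by (rule Bochner_Integration.integrable_bound) (auto simp: indicator_def)
  have sq_int: "integrable \<zeta> (\<lambda>z. (w + z)\<^sup>2)"
    unfolding power2_sum using int by auto
  have sq: "(LINT z|\<zeta>. (w + z)\<^sup>2) = w\<^sup>2 + s"
    unfolding power2_sum using int mean s by (simp add: prob_space)
  have cap_int: "integrable \<zeta> (\<lambda>z. min ((w + z)\<^sup>2) ((2 * \<Gamma>)\<^sup>2))"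
    by (rule integrable_const_bound[where B = "(2 * \<Gamma>)\<^sup>2"]) auto
  have "w\<^sup>2 + s / 2 \<le> (w\<^sup>2 + s) - 4 * (LINT z|\<zeta>. ?t z)" using tail by simp
  also have "\<dots> = (LINT z|\<zeta>. (w + z)\<^sup>2 - 4 * ?t z)"
    using sq_int tail_int sq by simp
  also have "\<dots> \<le> (LINT z|\<zeta>. min ((w + z)\<^sup>2) ((2 * \<Gamma>)\<^sup>2))"
    using sq_int tail_int cap_int capped_square_ge[OF w] by (intro integral_mono) auto
  finally have "2 / s * (9 * \<Gamma>\<^sup>2 - (LINT z|\<zeta>. min ((w + z)\<^sup>2) ((2 * \<Gamma>)\<^sup>2)))
      \<le> 2 / s * (9 * \<Gamma>\<^sup>2 - w\<^sup>2 - s / 2)"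
    using s by (intro mult_left_mono) auto
  thus ?thesis unfolding capped_potential_def using cap_int by (simp add: prob_space)
qed

text \<open>
  Beyond \<open>\<Gamma>\<close> killing alone is enough.  Within \<open>{- \<Gamma>..\<Gamma>}\<close> the variance pays for the summand \<open>1\<close>
  and killing pays for the drift: the drift costs \<open>y\<^sup>2 - (h y)\<^sup>2 \<le> 2 * \<Gamma> * \<bar>y - h y\<bar>\<close>, which
  is at most \<open>4 * \<Gamma> * (1 - h' y)\<close>, while killing gains at least \<open>7 * \<Gamma>\<^sup>2 * (1 - h' y)\<close>, both up
  to the common factor \<open>2 / s\<close>.
\<close>

lemma capped_potential_superharmonic:
  assumes "prob_space \<zeta>" and "sets \<zeta> = sets borel"
    and "integrable \<zeta> (\<lambda>x. x)" "integrable \<zeta> (\<lambda>x. x\<^sup>2)" and "(LINT x|\<zeta>. x) = 0"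
    and "s = (LINT x|\<zeta>. x\<^sup>2)" and s: "s > 0"
    and tail: "(LINT x|\<zeta>. x\<^sup>2 * indicator {x. \<Gamma> \<le> \<bar>x\<bar>} x) \<le> s / 8"
    and \<Gamma>: "\<Gamma> \<ge> 1" "s \<le> \<Gamma>\<^sup>2"
  shows "1 + h_slope \<Gamma> y * (LINT z|\<zeta>. capped_potential s \<Gamma> (h \<Gamma> y + z)) \<le> capped_potential s \<Gamma> y"
proof -
  have \<Gamma>0: "\<Gamma> > 0" using \<Gamma> by simp
  define d where "d = h_slope \<Gamma> y"
  have d0: "0 \<le> d" using h_slope_nonneg[OF \<Gamma>0] by (simp add: d_def)
  have w: "\<bar>h \<Gamma> y\<bar> \<le> \<Gamma>" using h_bounded[OF \<Gamma>0, of y] by simp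
  have w2: "(h \<Gamma> y)\<^sup>2 \<le> \<Gamma>\<^sup>2" using w by (metis abs_ge_zero power2_abs power_mono)
  have E: "d * (LINT z|\<zeta>. capped_potential s \<Gamma> (h \<Gamma> y + z))
      \<le> d * (2 / s * (9 * \<Gamma>\<^sup>2 - (h \<Gamma> y)\<^sup>2 - s / 2))"
    using expected_capped_potential_le[OF assms(1-8) w] d0 by (rule mult_left_mono)
  show ?thesis
  proof (cases "\<Gamma> \<le> \<bar>y\<bar>")
    case True
    have "0 \<le> 9 * \<Gamma>\<^sup>2 - (h \<Gamma> y)\<^sup>2 - s / 2"
      using w2 \<Gamma> zero_le_power2[of \<Gamma>] by linarith
    moreover have "9 * \<Gamma>\<^sup>2 - (h \<Gamma> y)\<^sup>2 - s / 2 \<le> 9 * \<Gamma>\<^sup>2"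
      using s zero_le_power2[of "h \<Gamma> y"] by linarith
    ultimately have "d * (2 / s * (9 * \<Gamma>\<^sup>2 - (h \<Gamma> y)\<^sup>2 - s / 2)) \<le> 1 / 2 * (2 / s * (9 * \<Gamma>\<^sup>2))"
      using h_slope_le_half[OF True] s d0
      by (intro mult_mono) (auto simp: d_def)
    moreover have "1 \<le> \<Gamma>\<^sup>2 / s" using \<Gamma> s by simp
    moreover have "10 / s * \<Gamma>\<^sup>2 \<le> capped_potential s \<Gamma> y" using capped_potential_bounds[OF s] by blast
    ultimately show ?thesis using E by (simp add: d_def)
  next
    case False
    hence y: "\<bar>y\<bar> \<le> \<Gamma>" by simp
    hence "\<bar>y\<bar> \<le> 2 * \<Gamma>" using \<Gamma>0 by linarith
    hence "y\<^sup>2 \<le> (2 * \<Gamma>)\<^sup>2" by (metis abs_ge_zero power2_abs power_mono)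
    hence V: "capped_potential s \<Gamma> y = 2 / s * (9 * \<Gamma>\<^sup>2 - y\<^sup>2)"
      by (simp only: capped_potential_def min_absorb1)
    have d1: "0 \<le> 1 - d" using h_drift_le_slope_defect[OF y] by (simp add: d_def)
    have "y\<^sup>2 - (h \<Gamma> y)\<^sup>2 \<le> \<bar>y - h \<Gamma> y\<bar> * \<bar>y + h \<Gamma> y\<bar>"
      by (simp add: power2_eq_square algebra_simps flip: abs_mult) 
    also have "\<dots> \<le> (2 * (1 - d)) * (2 * \<Gamma>)"
      using h_drift_le_slope_defect[OF y] y w d1 by (intro mult_mono) (auto simp: d_def)
    also have "\<dots> \<le> (1 - d) * (7 * \<Gamma>\<^sup>2)"
    proof -
      have "4 * \<Gamma> \<le> 7 * \<Gamma>\<^sup>2" using \<Gamma> by (simp add: power2_eq_square)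
      thus ?thesis using d1 mult_left_mono[of "4 * \<Gamma>" "7 * \<Gamma>\<^sup>2" "1 - d"]
        by (simp only: mult_ac) (simp add: algebra_simps)
    qed
    also have "\<dots> \<le> (1 - d) * (9 * \<Gamma>\<^sup>2 - (h \<Gamma> y)\<^sup>2 - s / 2)"
      using d1 w2 \<Gamma> s by (intro mult_left_mono) auto
    finally have "s / 2 + d * (9 * \<Gamma>\<^sup>2 - (h \<Gamma> y)\<^sup>2 - s / 2) \<le> 9 * \<Gamma>\<^sup>2 - y\<^sup>2"
      unfolding left_diff_distrib by simp
    hence "2 / s * (s / 2 + d * (9 * \<Gamma>\<^sup>2 - (h \<Gamma> y)\<^sup>2 - s / 2)) \<le> 2 / s * (9 * \<Gamma>\<^sup>2 - y\<^sup>2)"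
      using s by (intro mult_left_mono) auto
    moreover have "2 / s * (s / 2 + d * (9 * \<Gamma>\<^sup>2 - (h \<Gamma> y)\<^sup>2 - s / 2))
        = 1 + d * (2 / s * (9 * \<Gamma>\<^sup>2 - (h \<Gamma> y)\<^sup>2 - s / 2))"
      using s by (simp add: field_simps)
    ultimately show ?thesis using E V by (simp add: d_def)
  qed
qed

lemma second_moment_tail_tendsto_0:
  assumes [measurable_cong]: "sets \<zeta> = sets borel" and "integrable \<zeta> (\<lambda>x::real. x\<^sup>2)"
  shows "((\<lambda>\<Gamma>. LINT x|\<zeta>. x\<^sup>2 * indicator {x. \<Gamma> \<le> \<bar>x\<bar>} x) \<longlongrightarrow> 0) at_top"
proof -
  have "((\<lambda>\<Gamma>. LINT x|\<zeta>. x\<^sup>2 * indicator {x. \<Gamma> \<le> \<bar>x\<bar>} x) \<longlongrightarrow> (LINT x|\<zeta>. 0)) at_top"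
  proof (rule integral_dominated_convergence_at_top[where w = "\<lambda>x. x\<^sup>2"])
    show "AE x in \<zeta>. ((\<lambda>\<Gamma>. x\<^sup>2 * indicator {x. \<Gamma> \<le> \<bar>x\<bar>} x) \<longlongrightarrow> 0) at_top"
    proof (rule AE_I2)
      fix x :: real
      have "\<forall>\<^sub>F \<Gamma> in at_top. x\<^sup>2 * indicator {x. \<Gamma> \<le> \<bar>x\<bar>} x = 0"
        using eventually_gt_at_top[of "\<bar>x\<bar>"] by eventually_elim (simp add: indicator_def)
      thus "((\<lambda>\<Gamma>. x\<^sup>2 * indicator {x. \<Gamma> \<le> \<bar>x\<bar>} x) \<longlongrightarrow> 0) at_top"
        by (rule tendsto_eventually)
    qed
  qed (use assms(2) in \<open>auto simp: indicator_def\<close>)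
  thus ?thesis by simp
qed

section \<open>Risk functions\<close>

text \<open>
  A risk function tends to \<open>1\<close> at \<open>-\<infinity>\<close> and is never integrable itself; subtracting the risk function
  of the constant \<open>0\<close> cures this.  By Tonelli's theorem the \<open>L\<^sup>1\<close> norm of the difference is at most
  \<open>E \<bar>A\<bar>\<close>, because for each outcome the two indicators differ exactly between \<open>0\<close> and \<open>A\<close>.
\<close>

lemma integrable_risk_function_minus_step:
  fixes A :: "'a \<Rightarrow> real"
  assumes "prob_space M" and A: "integrable M A"
  shows "integrable lborel (\<lambda>x. risk_function M A x - indicator {..<0} x)"
proof -
  interpret prob_space M by fact
  interpret pair_sigma_finite lborel M ..
  have [measurable]: "A \<in> borel_measurable M" using A by simp
  let ?i = "\<lambda>x \<omega>. indicator {x<..} (A \<omega>) - indicator {..<0} x :: real"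
  have risk: "risk_function M A x - indicator {..<0} x = (LINT \<omega>|M. ?i x \<omega>)" for x
  proof -
    have "risk_function M A x = (LINT \<omega>|M. indicator {\<omega> \<in> space M. A \<omega> > x} \<omega>)"
      by (simp add: risk_function_def)
    also have "\<dots> = (LINT \<omega>|M. indicator {x<..} (A \<omega>))"
      by (intro Bochner_Integration.integral_cong) (auto simp: indicator_def)
    moreover have "integrable M (\<lambda>\<omega>. indicator {x<..} (A \<omega>) :: real)"
      by (rule integrable_const_bound[where B = 1]) auto
    ultimately show ?thesis by (simp add: prob_space)
  qed
  have [measurable]: "case_prod ?i \<in> borel_measurable (lborel \<Otimes>\<^sub>M M)"
  proof -
    have "case_prod ?i = (\<lambda>p. (if fst p < A (snd p) then 1 else 0) - (if fst p < 0 then 1 else 0))"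
      by (auto simp: indicator_def fun_eq_iff)
    thus ?thesis by simp
  qed
  have "(\<integral>\<^sup>+x. ennreal (norm (LINT \<omega>|M. ?i x \<omega>)) \<partial>lborel)
      \<le> (\<integral>\<^sup>+x. (\<integral>\<^sup>+\<omega>. ennreal \<bar>?i x \<omega>\<bar> \<partial>M) \<partial>lborel)"
  proof (intro nn_integral_mono)
    fix x
    have "integrable M (?i x)"
      by (rule integrable_const_bound[where B = 1]) (auto simp: indicator_def)
    thus "ennreal (norm (LINT \<omega>|M. ?i x \<omega>)) \<le> (\<integral>\<^sup>+\<omega>. ennreal \<bar>?i x \<omega>\<bar> \<partial>M)"
      using integral_norm_bound_ennreal by fastforce
  qed
  also have "\<dots> = (\<integral>\<^sup>+\<omega>. (\<integral>\<^sup>+x. ennreal \<bar>?i x \<omega>\<bar> \<partial>lborel) \<partial>M)"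
    by (rule Fubini'[symmetric]) measurable
  also have "\<dots> = (\<integral>\<^sup>+\<omega>. ennreal \<bar>A \<omega>\<bar> \<partial>M)"
  proof (intro nn_integral_cong)
    fix \<omega>
    have "(\<integral>\<^sup>+x. ennreal \<bar>?i x \<omega>\<bar> \<partial>lborel)
        = (\<integral>\<^sup>+x. indicator {min 0 (A \<omega>)..<max 0 (A \<omega>)} x \<partial>lborel)"
      by (intro nn_integral_cong) (auto simp: indicator_def min_def max_def)
    also have "\<dots> = ennreal \<bar>A \<omega>\<bar>" by (simp add: min_def max_def)
    finally show "(\<integral>\<^sup>+x. ennreal \<bar>?i x \<omega>\<bar> \<partial>lborel) = ennreal \<bar>A \<omega>\<bar>" .
  qed
  also have "\<dots> < \<infinity>" using A by (simp add: integrable_iff_bounded)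
  finally have "integrable lborel (\<lambda>x. LINT \<omega>|M. ?i x \<omega>)"
    by (intro integrableI_bounded) auto
  thus ?thesis by (simp add: risk)
qed

lemma integrable_risk_function_diff:
  assumes "is_L1_risk_function G\<^sub>1" "is_L1_risk_function G\<^sub>2"
  shows "integrable lborel (\<lambda>x. G\<^sub>1 x - G\<^sub>2 x)"
proof -
  have *: "integrable lborel (\<lambda>x. G x - indicator {..<0} x)" if "is_L1_risk_function G" for G
    using that integrable_risk_function_minus_step unfolding is_L1_risk_function_def by blast
  show ?thesis using Bochner_Integration.integrable_diff[OF *[OF assms(1)] *[OF assms(2)]] by simp
qed

section \<open>The bound\<close>

lemma second_moment_pos:
  fixes z :: "'a \<Rightarrow> real"
  assumes "integrable M (\<lambda>\<omega>. (z \<omega>)\<^sup>2)" and "\<not> (\<exists>c. AE \<omega> in M. z \<omega> = c)"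
  shows "0 < (LINT \<omega>|M. (z \<omega>)\<^sup>2)"
proof (rule ccontr)
  assume "\<not> 0 < (LINT \<omega>|M. (z \<omega>)\<^sup>2)"
  moreover have "0 \<le> (LINT \<omega>|M. (z \<omega>)\<^sup>2)" by simp
  ultimately have "(LINT \<omega>|M. (z \<omega>)\<^sup>2) = 0" by linarith
  hence "AE \<omega> in M. z \<omega> = 0"
    using integral_nonneg_eq_0_iff_AE[OF assms(1)] by simp
  thus False using assms(2) by blast
qed

theorem theorem3p3:
  fixes M :: "'a measure" and z :: "'a \<Rightarrow> real" and \<zeta> :: "real measure"
  assumes "prob_space M"
    and "integrable M z"
    and "\<not> (\<exists>c. AE \<omega> in M. z \<omega> = c)"
    and "(LINT \<omega>|M. z \<omega>) = 0"
    and "integrable M (\<lambda>\<omega>. (z \<omega>)\<^sup>2)"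
    and "\<zeta> = distr M borel z"
  shows "\<exists>\<Gamma>\<^sub>0>0. \<forall>\<Gamma>\<ge>\<Gamma>\<^sub>0. \<forall>G G\<^sub>1 G\<^sub>2.
           is_L1_risk_function G\<^sub>1 \<longrightarrow> is_L1_risk_function G\<^sub>2 \<longrightarrow> G = (\<lambda>x. G\<^sub>1 x - G\<^sub>2 x) \<longrightarrow>
             (\<forall>n. integrable lborel ((T0 \<zeta> \<Gamma> ^^ n) G)) \<and>
             summable (\<lambda>n. L1_norm ((T0 \<zeta> \<Gamma> ^^ n) G)) \<and>
             (\<Sum>n. L1_norm ((T0 \<zeta> \<Gamma> ^^ n) G))
               \<le> 75 / (LINT \<omega>|M. (z \<omega>)\<^sup>2) * \<Gamma>\<^sup>2 * L1_norm G"
proof -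
  have [measurable]: "z \<in> borel_measurable M" using assms(2) by simp
  define s where "s = (LINT x|\<zeta>. x\<^sup>2)"
  have s_M: "s = (LINT \<omega>|M. (z \<omega>)\<^sup>2)" unfolding s_def assms(6) by (rule integral_distr) auto
  have s: "s > 0" using second_moment_pos[OF assms(5,3)] by (simp add: s_M)
  have prob: "prob_space \<zeta>" unfolding assms(6)
    by (rule prob_space.prob_space_distr[OF assms(1)]) simp
  have sets: "sets \<zeta> = sets borel" by (simp add: assms(6))
  have int: "integrable \<zeta> (\<lambda>x. x)" "integrable \<zeta> (\<lambda>x. x\<^sup>2)"
    using assms(2,5) by (auto simp: assms(6) integrable_distr_eq)
  have mean: "(LINT x|\<zeta>. x) = 0" using assms(4) by (simp add: assms(6) integral_distr)
  have "\<forall>\<^sub>F \<Gamma> in at_top. (LINT x|\<zeta>. x\<^sup>2 * indicator {x. \<Gamma> \<le> \<bar>x\<bar>} x) < s / 8"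
    using s by (intro order_tendstoD(2)[OF second_moment_tail_tendsto_0[OF sets int(2)]]) simp
  then obtain B where B: "\<And>\<Gamma>. \<Gamma> \<ge> B \<Longrightarrow> (LINT x|\<zeta>. x\<^sup>2 * indicator {x. \<Gamma> \<le> \<bar>x\<bar>} x) < s / 8"
    unfolding eventually_at_top_linorder by blast
  \<comment> \<open>Besides the tail bound, \<open>4 * \<Gamma> \<le> 7 * \<Gamma>\<^sup>2\<close> and \<open>s \<le> \<Gamma>\<^sup>2\<close> are needed for the potential.\<close>
  define \<Gamma>\<^sub>0 where "\<Gamma>\<^sub>0 = max B (max 1 (sqrt s))"
  show ?thesis
  proof (intro exI[of _ \<Gamma>\<^sub>0] conjI allI impI)
    show "\<Gamma>\<^sub>0 > 0" by (simp add: \<Gamma>\<^sub>0_def)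
    fix \<Gamma> :: real and G G\<^sub>1 G\<^sub>2 :: "real \<Rightarrow> real"
    assume "\<Gamma> \<ge> \<Gamma>\<^sub>0" and risk: "is_L1_risk_function G\<^sub>1" "is_L1_risk_function G\<^sub>2"
      and G: "G = (\<lambda>x. G\<^sub>1 x - G\<^sub>2 x)"
    hence \<Gamma>: "\<Gamma> \<ge> B" "\<Gamma> \<ge> 1" "sqrt s \<le> \<Gamma>" by (auto simp: \<Gamma>\<^sub>0_def)
    hence \<Gamma>0: "\<Gamma> > 0" by simp
    have s_le: "s \<le> \<Gamma>\<^sup>2" using \<Gamma>(3) by (rule sqrt_le_D)
    have G_int: "integrable lborel G" unfolding G by (rule integrable_risk_function_diff[OF risk])
    let ?V = "capped_potential s \<Gamma>" and ?c = "18 / s * \<Gamma>\<^sup>2"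
    have V_meas[measurable]: "?V \<in> borel_measurable borel"
      unfolding capped_potential_def[abs_def] by measurable
    have V_nonneg: "0 \<le> ?V y" for y
      using capped_potential_bounds(1)[OF s, of \<Gamma> y] s
      by (meson divide_nonneg_pos mult_nonneg_nonneg order_trans zero_le_numeral zero_le_power2)
    have super: "1 + ennreal (h_slope \<Gamma> y) * (\<integral>\<^sup>+x. ennreal (?V (h \<Gamma> y + x)) \<partial>\<zeta>) \<le> ennreal (?V y)"
      for y
    proof -
      interpret prob_space \<zeta> by (rule prob)
      note sets[measurable_cong]
      have "integrable \<zeta> (\<lambda>x. ?V (h \<Gamma> y + x))"
        using V_nonneg capped_potential_bounds(2)[OF s]
        by (intro integrable_const_bound[where B = ?c]) (auto simp del: times_divide_eq_left)
      hence "(\<integral>\<^sup>+x. ennreal (?V (h \<Gamma> y + x)) \<partial>\<zeta>) = ennreal (LINT x|\<zeta>. ?V (h \<Gamma> y + x))"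
        by (rule nn_integral_eq_integral) (simp add: V_nonneg)
      moreover have "0 \<le> (LINT x|\<zeta>. ?V (h \<Gamma> y + x))" by (simp add: V_nonneg)
      moreover have "1 + h_slope \<Gamma> y * (LINT x|\<zeta>. ?V (h \<Gamma> y + x)) \<le> ?V y"
        using capped_potential_superharmonic[OF prob sets int mean s_def s _ \<Gamma>(2) s_le] B[OF \<Gamma>(1)]
        by simp
      ultimately show ?thesis
        using h_slope_nonneg[OF \<Gamma>0, of y] ennreal_leI
        by (simp flip: ennreal_mult ennreal_plus ennreal_1)
    qed
    note bounds = T0_iterates_summable[OF prob sets \<Gamma>0 _ G_int super, of ?c]
    have V_le: "ennreal (?V y) \<le> ennreal ?c" for y
      by (rule ennreal_leI) (rule capped_potential_bounds(2)[OF s])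
    have c: "0 \<le> ?c" using s by simp
    show "integrable lborel ((T0 \<zeta> \<Gamma> ^^ n) G)" for n
      using V_le c by (intro bounds(1)) auto
    show "summable (\<lambda>n. L1_norm ((T0 \<zeta> \<Gamma> ^^ n) G))"
      using V_le c by (intro bounds(2)) auto
    have "(\<Sum>n. L1_norm ((T0 \<zeta> \<Gamma> ^^ n) G)) \<le> ?c * L1_norm G"
      using V_le c by (intro bounds(3)) auto
    also have "\<dots> \<le> 75 / s * \<Gamma>\<^sup>2 * L1_norm G"
      using s by (intro mult_right_mono divide_right_mono) (auto simp: L1_norm_def)
    finally show "(\<Sum>n. L1_norm ((T0 \<zeta> \<Gamma> ^^ n) G))
        \<le> 75 / (LINT \<omega>|M. (z \<omega>)\<^sup>2) * \<Gamma>\<^sup>2 * L1_norm G" by (simp add: s_M)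
  qed
qed

end
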